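(* Let $\mathfrak{g}=\mathfrak{g}_{4.7}$ be the four-dimensional real Lie algebra with basis $\mathcal{B}=\{e_1,e_2,e_3,e_4\}$ whose nonzero Lie brackets (up to skew-symmetry) are $[e_1,e_4]=2e_1$, $[e_2,e_4]=e_2$, $[e_3,e_4]=e_2+e_3$, $[e_2,e_3]=e_1$. Let $\langle\cdot,\cdot\rangle$ be a pseudo-Riemannian inner product on $\mathfrak{g}$ and let $(R_{ij})$ be the matrix of its Ricci operator $\operatorname{Ric}$ in the basis $\mathcal{B}$. If $$R_{i1}=0\ (i=2,3,4),\quad R_{32}=R_{42}=R_{43}=0,\quad R_{34}=-R_{12},\quad R_{24}=R_{13}-R_{12},$$ $$R_{33}=R_{22},\quad R_{44}=R_{22}+R_{33}-R_{11},$$ then $\langle\cdot,\cdot\rangle$ is an algebraic Ricci soliton. In this situation, $\operatorname{Ric}=\eta I_4+D$ where $\eta=R_{44}=R_{22}+R_{33}-R_{11}$ and $$D=\begin{bmatrix}R_{11}-R_{44}&R_{12}&R_{13}&R_{14}\\0&R_{22}-R_{44}&R_{23}&R_{13}-R_{12}\\0&0&R_{22}-R_{44}&-R_{12}\\0&0&0&0\end{bmatrix}$$ is (the matrix in the basis $\mathcal{B}$ of) a derivation of $\mathfrak{g}$.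
   Context: A pseudo-Riemannian inner product on a real Lie algebra $\mathfrak{g}$ is a nondegenerate symmetric bilinear form $\langle\cdot,\cdot\rangle$ on $\mathfrak{g}$ (of some signature $(r,s)$). Its Levi-Civita connection $\nabla$ is defined by $2\langle\nabla_uv,w\rangle=\langle[u,v],w\rangle+\langle[w,u],v\rangle+\langle[w,v],u\rangle$; its curvature is $R_{uv}=\nabla_{[u,v]}-[\nabla_u,\nabla_v]$; its Ricci curvature $\operatorname{ric}(u,v)$ is the trace of $w\mapsto R_{uw}v$; its Ricci operator $\operatorname{Ric}$ is the endomorphism of $\mathfrak{g}$ with $\langle\operatorname{Ric}(u),v\rangle=\operatorname{ric}(u,v)$. The matrix $(R_{ij})$ of $\operatorname{Ric}$ in a basis $\{e_i\}$ is given by $\operatorname{Ric}(e_j)=\sum_iR_{ij}e_i$ (the same column convention is used for $D$). A derivation is a linear map $D:\mathfrak{g}\to\mathfrak{g}$ with $D[x,y]=[D(x),y]+[x,D(y)]$ for all $x,y$. The inner product is an algebraic Ricci soliton if $\operatorname{Ric}=\eta\,\mathrm{Id}_{\mathfrak{g}}+D$ for some $\eta\in\mathbb{R}$ and some derivation $D$ of $\mathfrak{g}$. *)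

theory Defs
  imports "HOL-Analysis.Analysis"
begin

text \<open>
  A Lie algebra on the space \<open>real ^ 'n\<close> is given by its bracket \<open>br\<close>, and an inner product on it
  by a bilinear form \<open>g\<close>.
\<close>

definition lie_bracket :: "('a::real_vector \<Rightarrow> 'a \<Rightarrow> 'a) \<Rightarrow> bool" where
  "lie_bracket br \<longleftrightarrow> bilinear br \<and> (\<forall>x. br x x = 0) \<and>
     (\<forall>x y z. br x (br y z) + br y (br z x) + br z (br x y) = 0)"

definition pseudo_riemannian :: "('a::real_vector \<Rightarrow> 'a \<Rightarrow> real) \<Rightarrow> bool" where
  "pseudo_riemannian g \<longleftrightarrow> bilinear g \<and> (\<forall>u v. g u v = g v u) \<and>
     (\<forall>u. (\<forall>v. g u v = 0) \<longrightarrow> u = 0)"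

definition levi_civita ::
    "('a::real_vector \<Rightarrow> 'a \<Rightarrow> 'a) \<Rightarrow> ('a \<Rightarrow> 'a \<Rightarrow> real) \<Rightarrow> 'a \<Rightarrow> 'a \<Rightarrow> 'a" where
  "levi_civita br g u v =
     (THE z. \<forall>w. 2 * g z w = g (br u v) w + g (br w u) v + g (br w v) u)"

text \<open>The sign convention is \<open>R\<^sub>u\<^sub>v = \<nabla>\<^bsub>[u,v]\<^esub> - [\<nabla>\<^sub>u, \<nabla>\<^sub>v]\<close>.\<close>

definition curvature ::
    "('a::real_vector \<Rightarrow> 'a \<Rightarrow> 'a) \<Rightarrow> ('a \<Rightarrow> 'a \<Rightarrow> real) \<Rightarrow> 'a \<Rightarrow> 'a \<Rightarrow> 'a \<Rightarrow> 'a" where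
  "curvature br g u v w =
     levi_civita br g (br u v) w
     - (levi_civita br g u (levi_civita br g v w) - levi_civita br g v (levi_civita br g u w))"

definition ricci_curvature ::
    "(real^'n \<Rightarrow> real^'n \<Rightarrow> real^'n) \<Rightarrow> (real^'n \<Rightarrow> real^'n \<Rightarrow> real) \<Rightarrow> real^'n \<Rightarrow> real^'n \<Rightarrow> real" where
  "ricci_curvature br g u v = trace (matrix (\<lambda>w. curvature br g u w v))"

definition ricci_operator ::
    "(real^'n \<Rightarrow> real^'n \<Rightarrow> real^'n) \<Rightarrow> (real^'n \<Rightarrow> real^'n \<Rightarrow> real) \<Rightarrow> real^'n \<Rightarrow> real^'n" where
  "ricci_operator br g u = (THE z. \<forall>v. g z v = ricci_curvature br g u v)"

definition derivation :: "('a::real_vector \<Rightarrow> 'a \<Rightarrow> 'a) \<Rightarrow> ('a \<Rightarrow> 'a) \<Rightarrow> bool" where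
  "derivation br D \<longleftrightarrow> linear D \<and> (\<forall>x y. D (br x y) = br (D x) y + br x (D y))"

definition algebraic_ricci_soliton ::
    "(real^'n \<Rightarrow> real^'n \<Rightarrow> real^'n) \<Rightarrow> (real^'n \<Rightarrow> real^'n \<Rightarrow> real) \<Rightarrow> bool" where
  "algebraic_ricci_soliton br g \<longleftrightarrow>
     (\<exists>\<eta> D. derivation br D \<and> (\<forall>u. ricci_operator br g u = \<eta> *\<^sub>R u + D u))"

text \<open>
  The Lie algebra \<open>\<gg>\<^bsub>4.7\<^esub>\<close> on \<open>real ^ 4\<close>, with \<open>e\<^sub>i = axis i 1\<close>. Below, the bracket is written
  out as the bilinear alternating extension of its values on the basis, which the lemma
  \<open>g47_brackets\<close> lists.
\<close>

definition g47 :: "real^4 \<Rightarrow> real^4 \<Rightarrow> real^4" where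
  "g47 x y = vector
     [2 * (x$1 * y$4 - x$4 * y$1) + (x$2 * y$3 - x$3 * y$2),
      (x$2 * y$4 - x$4 * y$2) + (x$3 * y$4 - x$4 * y$3),
      x$3 * y$4 - x$4 * y$3,
      0]"

lemma vector_4 [simp]:
  "(vector [a, b, c, d] :: 'a::zero^4) $ 1 = a"
  "(vector [a, b, c, d] :: 'a::zero^4) $ 2 = b"
  "(vector [a, b, c, d] :: 'a::zero^4) $ 3 = c"
  "(vector [a, b, c, d] :: 'a::zero^4) $ 4 = d"
  by (simp_all add: vector_def)

lemma g47_nth [simp]:
  "g47 x y $ 1 = 2 * (x$1 * y$4 - x$4 * y$1) + (x$2 * y$3 - x$3 * y$2)"
  "g47 x y $ 2 = (x$2 * y$4 - x$4 * y$2) + (x$3 * y$4 - x$4 * y$3)"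
  "g47 x y $ 3 = x$3 * y$4 - x$4 * y$3"
  "g47 x y $ 4 = 0"
  by (simp_all add: g47_def)

lemma g47_brackets:
  fixes e :: "4 \<Rightarrow> real^4"
  defines "e \<equiv> \<lambda>i. axis i 1"
  shows "g47 (e 1) (e 4) = 2 *\<^sub>R e 1" "g47 (e 2) (e 4) = e 2" "g47 (e 3) (e 4) = e 2 + e 3"
    "g47 (e 2) (e 3) = e 1" "g47 (e 1) (e 2) = 0" "g47 (e 1) (e 3) = 0"
  unfolding e_def by (simp_all add: vec_eq_iff forall_4 axis_def)

lemma lie_bracket_g47: "lie_bracket g47"
  unfolding lie_bracket_def bilinear_def
  by (auto intro!: linearI simp: vec_eq_iff forall_4 algebra_simps)

text \<open>Nondegeneracy makes the descriptions in \<open>levi_civita\<close> and \<open>ricci_operator\<close> proper.\<close>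

lemma pseudo_riemannian_represent:
  fixes g :: "real^'n \<Rightarrow> real^'n \<Rightarrow> real"
  assumes g: "pseudo_riemannian g" and f: "linear f"
  shows "\<exists>!z. \<forall>w. g z w = f w"
proof -
  have bil: "bilinear g" and nd: "\<And>u. (\<And>v. g u v = 0) \<Longrightarrow> u = 0"
    using g by (auto simp: pseudo_riemannian_def)
  define T :: "real^'n \<Rightarrow> real^'n" where "T = (\<lambda>z. \<chi> i. g z (axis i 1))"
  have linT: "linear T"
    by (rule linearI) (auto simp: T_def vec_eq_iff bilinear_ladd[OF bil] bilinear_lmul[OF bil])
  have ext: "(\<forall>w. g z w = h w) \<longleftrightarrow> (\<forall>i. g z (axis i 1) = h (axis i 1))" if "linear h" for z h
  proof
    assume *: "\<forall>i. g z (axis i 1) = h (axis i 1)"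
    have "linear (g z)" using bil by (simp add: bilinear_def)
    then have "g z = h"
      by (rule linear_eq_stdbasis[OF _ that]) (use * in \<open>auto simp: Basis_vec_def\<close>)
    then show "\<forall>w. g z w = h w" by simp
  qed simp
  have "inj T"
    unfolding linear_injective_0[OF linT]
  proof (intro allI impI)
    fix z assume "T z = 0"
    then have "\<forall>w. g z w = 0"
      using ext[of "\<lambda>_. 0" z] by (simp add: T_def vec_eq_iff linear_zero)
    then show "z = 0" using nd by blast
  qed
  then have "surj T" using linT linear_injective_imp_surjective by blast
  have "(\<forall>w. g z w = f w) \<longleftrightarrow> T z = (\<chi> i. f (axis i 1))" for z
    using ext[OF f, of z] by (simp add: T_def vec_eq_iff)
  then show ?thesis
    using \<open>inj T\<close> \<open>surj T\<close> by (metis injD surjD)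
qed

lemma levi_civita_koszul:
  fixes g :: "real^'n \<Rightarrow> real^'n \<Rightarrow> real"
  assumes g: "pseudo_riemannian g" and br: "bilinear br"
  shows "2 * g (levi_civita br g u v) w = g (br u v) w + g (br w u) v + g (br w v) u"
proof -
  have bil: "bilinear g" using g by (simp add: pseudo_riemannian_def)
  have "linear (\<lambda>w. (g (br u v) w + g (br w u) v + g (br w v) u) / 2)"
    by (rule linearI)
      (simp_all add: bilinear_ladd[OF bil] bilinear_radd[OF bil] bilinear_lmul[OF bil]
        bilinear_rmul[OF bil] bilinear_ladd[OF br] bilinear_lmul[OF br] field_simps)
  from pseudo_riemannian_represent[OF g this]
  have "\<exists>!z. \<forall>w. 2 * g z w = g (br u v) w + g (br w u) v + g (br w v) u"
    by (simp add: field_simps)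
  from theI'[OF this] show ?thesis unfolding levi_civita_def by blast
qed

end

theory Submission
  imports Defs
begin

text \<open>The geometry enters only through linearity: \<open>linear_ricci_operator\<close> shows
  that the Ricci operator is multiplication by its matrix \<open>R\<close>. The rest is algebra.
  With d = R11 - R22, the relations on \<open>R\<close> make \<open>R\<close> minus R44 times the
  identity equal to D = d diag(2,1,1,0) + R23 E23 + ad(x), where x = (R14/2) e1 + R13 e2 - R12 e3.
  The first summand is the grading derivation with weights 2, 1, 1, 0, the map E23 sending e3 to e2
  commutes suitably with the brackets, and ad(x) is inner; so D is a derivation. The code checks
  this in coordinates.\<close>

lemma pseudo_riemannian_eqI:
  assumes "pseudo_riemannian g" "\<And>w. g x w = g y w"
  shows "x = y"
proof -
  have bil: "bilinear g" and nd: "\<And>u. (\<And>v. g u v = 0) \<Longrightarrow> u = 0"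
    using assms(1) by (auto simp: pseudo_riemannian_def)
  have "x - y = 0" by (rule nd) (simp add: bilinear_lsub[OF bil] assms(2))
  then show ?thesis by simp
qed

text \<open>The Koszul formula is bilinear in the two arguments, and nondegeneracy of
  \<open>g\<close> transfers this from pairings to the vectors themselves.\<close>

lemma bilinear_levi_civita:
  fixes g :: "real^'n \<Rightarrow> real^'n \<Rightarrow> real"
  assumes g: "pseudo_riemannian g" and br: "bilinear br"
  shows "bilinear (levi_civita br g)"
proof -
  have bil: "bilinear g" using g by (simp add: pseudo_riemannian_def)
  note koszul = levi_civita_koszul[OF g br]
  note expand = bilinear_ladd[OF bil] bilinear_radd[OF bil] bilinear_lmul[OF bil]
    bilinear_rmul[OF bil] bilinear_ladd[OF br] bilinear_radd[OF br] bilinear_lmul[OF br]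
    bilinear_rmul[OF br]
  \<comment> \<open>The factor 2 is kept so that the left side of the Koszul formula appears
    literally; \<open>add\<close> and \<open>scale\<close> split the pairing without losing
    it.\<close>
  have *: "x = y" if "\<And>w. 2 * g x w = 2 * g y w" for x y
    by (rule pseudo_riemannian_eqI[OF g]) (use that in simp)
  have add: "2 * g (x + y) w = 2 * g x w + 2 * g y w" for x y w
    by (simp add: expand)
  have scale: "2 * g (c *\<^sub>R x) w = c * (2 * g x w)" for c x w
    by (simp add: expand)
  show ?thesis
    unfolding bilinear_def
    by (intro conjI allI linearI; rule *; unfold add scale koszul; simp add: expand algebra_simps)
qed

lemma ricci_curvature_sum:
  "ricci_curvature br g u v = (\<Sum>i\<in>UNIV. curvature br g u (axis i 1) v $ i)"
  by (simp add: ricci_curvature_def trace_def matrix_def)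

text \<open>For a fixed traced direction, each term of the curvature is a composition of the bracket
  and the connection, both bilinear; the trace is then a finite sum of bilinear terms.\<close>

lemma bilinear_ricci_curvature:
  fixes g :: "real^'n \<Rightarrow> real^'n \<Rightarrow> real"
  assumes g: "pseudo_riemannian g" and br: "bilinear br"
  shows "bilinear (ricci_curvature br g)"
proof -
  note lc = bilinear_levi_civita[OF g br]
  note expand = bilinear_ladd[OF br] bilinear_radd[OF br] bilinear_lmul[OF br] bilinear_rmul[OF br]
    bilinear_ladd[OF lc] bilinear_radd[OF lc] bilinear_lmul[OF lc] bilinear_rmul[OF lc]
  show ?thesis
    unfolding bilinear_def
    by (intro conjI allI linearI)
      (simp_all add: ricci_curvature_sum curvature_def expand sum_distrib_left
        flip: sum.distrib, simp_all add: algebra_simps)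
qed

lemma ricci_operator_inner:
  fixes g :: "real^'n \<Rightarrow> real^'n \<Rightarrow> real"
  assumes g: "pseudo_riemannian g" and br: "bilinear br"
  shows "g (ricci_operator br g u) v = ricci_curvature br g u v"
proof -
  have "linear (ricci_curvature br g u)"
    using bilinear_ricci_curvature[OF g br] by (simp add: bilinear_def)
  from theI'[OF pseudo_riemannian_represent[OF g this]]
  show ?thesis unfolding ricci_operator_def by blast
qed

lemma linear_ricci_operator:
  fixes g :: "real^'n \<Rightarrow> real^'n \<Rightarrow> real"
  assumes g: "pseudo_riemannian g" and br: "bilinear br"
  shows "linear (ricci_operator br g)"
proof -
  have bil: "bilinear g" using g by (simp add: pseudo_riemannian_def)
  note rc = bilinear_ricci_curvature[OF g br]
  show ?thesis
    by (rule linearI; rule pseudo_riemannian_eqI[OF g])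
      (simp_all add: bilinear_ladd[OF bil] bilinear_lmul[OF bil] ricci_operator_inner[OF g br]
        bilinear_ladd[OF rc] bilinear_lmul[OF rc])
qed

theorem theorem4p7:
  fixes g :: "real^4 \<Rightarrow> real^4 \<Rightarrow> real" and R :: "real^4^4"
  assumes "pseudo_riemannian g"
    and "R = matrix (ricci_operator g47 g)"
    and "R$2$1 = 0" "R$3$1 = 0" "R$4$1 = 0"
    and "R$3$2 = 0" "R$4$2 = 0" "R$4$3 = 0"
    and "R$3$4 = - (R$1$2)"
    and "R$2$4 = R$1$3 - R$1$2"
    and "R$3$3 = R$2$2"
    and "R$4$4 = R$2$2 + R$3$3 - R$1$1"
  shows "algebraic_ricci_soliton g47 g \<and>
    (let \<eta> = R$4$4;
         D = vector
           [vector [R$1$1 - R$4$4, R$1$2, R$1$3, R$1$4],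
            vector [0, R$2$2 - R$4$4, R$2$3, R$1$3 - R$1$2],
            vector [0, 0, R$2$2 - R$4$4, - (R$1$2)],
            vector [0, 0, 0, 0]] :: real^4^4
     in \<eta> = R$2$2 + R$3$3 - R$1$1 \<and>
        (\<forall>u. ricci_operator g47 g u = \<eta> *\<^sub>R u + D *v u) \<and>
        derivation g47 (\<lambda>u. D *v u))"
proof -
  define D :: "real^4^4" where "D = vector
    [vector [R$1$1 - R$4$4, R$1$2, R$1$3, R$1$4],
     vector [0, R$2$2 - R$4$4, R$2$3, R$1$3 - R$1$2],
     vector [0, 0, R$2$2 - R$4$4, - (R$1$2)],
     vector [0, 0, 0, 0]]"
  have "bilinear g47" using lie_bracket_g47 by (simp add: lie_bracket_def)
  then have "linear (ricci_operator g47 g)"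
    using assms(1) by (rule linear_ricci_operator[rotated])
  then have "ricci_operator g47 g u = R *v u" for u
    by (simp add: assms(2) matrix_works)
  \<comment> \<open>Entrywise: the vanishing entries and the relations for R34, R24 and R33 match
    \<open>D\<close>, while R44 stays a free symbol that cancels on the diagonal.\<close>
  moreover have "R *v u = R$4$4 *\<^sub>R u + D *v u" for u
    by (simp add: vec_eq_iff forall_4 matrix_vector_mult_def sum_4 D_def assms(3-11) algebra_simps)
  ultimately have ric: "\<forall>u. ricci_operator g47 g u = R$4$4 *\<^sub>R u + D *v u"
    by simp
  \<comment> \<open>Here R44 = 2 R22 - R11 is substituted, so that the diagonal shows the weights 2,
    1, 1, 0 times R11 - R22, and the Leibniz rule becomes a polynomial identity in independent
    parameters.\<close>
  have Dv: "(D *v u) $ 1 = 2 * (R$1$1 - R$2$2) * u$1 + R$1$2 * u$2 + R$1$3 * u$3 + R$1$4 * u$4"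
    "(D *v u) $ 2 = (R$1$1 - R$2$2) * u$2 + R$2$3 * u$3 + (R$1$3 - R$1$2) * u$4"
    "(D *v u) $ 3 = (R$1$1 - R$2$2) * u$3 - R$1$2 * u$4"
    "(D *v u) $ 4 = 0" for u
    by (simp_all add: matrix_vector_mult_def sum_4 D_def assms(11,12))
  have der: "derivation g47 (\<lambda>u. D *v u)"
    unfolding derivation_def vec_eq_iff forall_4 g47_nth vector_add_component Dv
    by (simp add: algebra_simps)
  have "algebraic_ricci_soliton g47 g"
    unfolding algebraic_ricci_soliton_def using ric der by blast
  then show ?thesis
    unfolding Let_def using ric der assms(12) unfolding D_def by blast
qed

end
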